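(* Let $(\mathfrak g,[\cdot,\cdot],\alpha)$ be a Hom-Lie algebra, let $V$ be a vector space, let $\beta\in GL(V)$, and let $\rho:\mathfrak g\to\mathfrak{gl}(V)$ be a representation of $(\mathfrak g,[\cdot,\cdot],\alpha)$ on $V$ with respect to $\beta$. Then for every $s=0,1,2,\dots$ and every $k\ge 0$, $$H^k(d^s)\cong H^k(d^{s+1}).$$
   Context: All vector spaces are over a fixed field. A Hom-Lie algebra is a triple $(\mathfrak g,[\cdot,\cdot],\alpha)$ consisting of a vector space $\mathfrak g$, a skewsymmetric bilinear map $[\cdot,\cdot]:\wedge^2\mathfrak g\to\mathfrak g$ and a linear map $\alpha:\mathfrak g\to\mathfrak g$ such that $\alpha[x,y]=[\alpha(x),\alpha(y)]$ and $[\alpha(x),[y,z]]+[\alpha(y),[z,x]]+[\alpha(z),[x,y]]=0$ for all $x,y,z\in\mathfrak g$. A representation of $(\mathfrak g,[\cdot,\cdot],\alpha)$ on $V$ with respect to $\beta\in\mathfrak{gl}(V)$ is a linear map $\rho:\mathfrak g\to\mathfrak{gl}(V)$ such that for all $x,y\in\mathfrak g$: $\rho(\alpha(x))\circ\beta=\beta\circ\rho(x)$ and $\rho([x,y])\circ\beta=\rho(\alpha(x))\circ\rho(y)-\rho(\alpha(y))\circ\rho(x)$. Here $\beta$ is assumed invertible. $C^k(\mathfrak g;V)$ is the space of linear maps $\wedge^k\mathfrak g\to V$ (skewsymmetric $k$-linear maps from $\mathfrak g^k$ to $V$), with $C^0(\mathfrak g;V)=V$. For $s=0,1,2,\dots$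 the operator $d^s:C^k(\mathfrak g;V)\to C^{k+1}(\mathfrak g;V)$ is $$d^s\eta(x_1,\dots,x_{k+1})=\sum_{i=1}^{k+1}(-1)^{i+1}\beta^{k+1+s}\rho(x_i)\beta^{-k-2-s}\,\eta(\alpha(x_1),\dots,\widehat{x_i},\dots,\alpha(x_{k+1}))+\sum_{i<j}(-1)^{i+j}\eta([x_i,x_j],\alpha(x_1),\dots,\widehat{x_{i,j}},\dots,\alpha(x_{k+1})),$$ where $\widehat{x_i}$ means that the entry $\alpha(x_i)$ is omitted, and $\widehat{x_{i,j}}$ means that both entries $\alpha(x_i)$ and $\alpha(x_j)$ are omitted. It satisfies $d^s\circ d^s=0$. $Z^k(d^s)=\{\eta\in C^k(\mathfrak g;V): d^s\eta=0\}$ is the space of closed $k$-cochains, $B^k(d^s)=d^s(C^{k-1}(\mathfrak g;V))$ is the space of exact $k$-cochains (with $B^0(d^s)=0$), and $H^k(d^s)=Z^k(d^s)/B^k(d^s)$. The symbol $\cong$ denotes isomorphism of vector spaces. *)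

theory Defs
  imports Complex_Main "HOL-Library.Function_Algebras" "HOL-Library.Set_Algebras"
begin

text \<open>
  Vector spaces over the field \<open>'k\<close> are given by their scalar multiplications
  (locale \<^locale>\<open>vector_space\<close>).  The wedge notation is read over an arbitrary field: a linear map
  out of the exterior power is a multilinear map that vanishes as soon as two arguments are equal.
  If the characteristic is not 2, this is the same as changing sign under transpositions; see
  \<open>alternating2_iff_skew\<close> and \<open>multilinear_alternating_iff_skew\<close> below.
\<close>

locale hom_lie_algebra =
  vector_space scale for scale :: "'k::field \<Rightarrow> 'g::ab_group_add \<Rightarrow> 'g" +
  fixes br :: "'g \<Rightarrow> 'g \<Rightarrow> 'g" and \<alpha> :: "'g \<Rightarrow> 'g"
  assumes linear_br_left: "Vector_Spaces.linear scale scale (\<lambda>x. br x y)"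
    and linear_br_right: "Vector_Spaces.linear scale scale (br x)"
    and br_self: "br x x = 0"
    and linear_\<alpha>: "Vector_Spaces.linear scale scale \<alpha>"
    and \<alpha>_br: "\<alpha> (br x y) = br (\<alpha> x) (\<alpha> y)"
    and hom_jacobi: "br (\<alpha> x) (br y z) + br (\<alpha> y) (br z x) + br (\<alpha> z) (br x y) = 0"

locale hom_lie_representation =
  hom_lie_algebra scaleg br \<alpha> + V: vector_space scalev
  for scaleg :: "'k::field \<Rightarrow> 'g::ab_group_add \<Rightarrow> 'g"
    and br :: "'g \<Rightarrow> 'g \<Rightarrow> 'g" and \<alpha> :: "'g \<Rightarrow> 'g"
    and scalev :: "'k \<Rightarrow> 'v::ab_group_add \<Rightarrow> 'v" +
  fixes \<beta> :: "'v \<Rightarrow> 'v" and \<rho> :: "'g \<Rightarrow> 'v \<Rightarrow> 'v"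
  assumes linear_\<beta>: "Vector_Spaces.linear scalev scalev \<beta>"
    and bij_\<beta>: "bij \<beta>"
    and linear_\<rho>_apply: "Vector_Spaces.linear scalev scalev (\<rho> x)"
    and linear_\<rho>: "Vector_Spaces.linear scaleg scalev (\<lambda>x. \<rho> x v)"
    and \<rho>_\<alpha>: "\<rho> (\<alpha> x) \<circ> \<beta> = \<beta> \<circ> \<rho> x"
    and \<rho>_br: "\<rho> (br x y) \<circ> \<beta> = (\<rho> (\<alpha> x) \<circ> \<rho> y) - (\<rho> (\<alpha> y) \<circ> \<rho> x)"

text \<open>
  A map on \<open>k\<close>-tuples is a function on lists that is set to zero on all lists of length other than
  \<open>k\<close>, so that it is determined by its values on \<open>k\<close>-tuples.  In particular,
  a 0-cochain is determined by its value at \<open>[]\<close>.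
\<close>

definition multilinear ::
  "('k::field \<Rightarrow> 'g::ab_group_add \<Rightarrow> 'g) \<Rightarrow> ('k \<Rightarrow> 'v::ab_group_add \<Rightarrow> 'v) \<Rightarrow> nat
    \<Rightarrow> ('g list \<Rightarrow> 'v) \<Rightarrow> bool"
  where "multilinear scaleg scalev k \<eta> \<longleftrightarrow>
    (\<forall>xs i. length xs = k \<longrightarrow> i < k \<longrightarrow>
      Vector_Spaces.linear scaleg scalev (\<lambda>x. \<eta> (xs[i := x])))"

definition cochains ::
  "('k::field \<Rightarrow> 'g::ab_group_add \<Rightarrow> 'g) \<Rightarrow> ('k \<Rightarrow> 'v::ab_group_add \<Rightarrow> 'v) \<Rightarrow> nat
    \<Rightarrow> ('g list \<Rightarrow> 'v) set"
  where "cochains scaleg scalev k =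
    {\<eta>. (\<forall>xs. length xs \<noteq> k \<longrightarrow> \<eta> xs = 0) \<and>
         multilinear scaleg scalev k \<eta> \<and>
         (\<forall>xs. length xs = k \<longrightarrow> \<not> distinct xs \<longrightarrow> \<eta> xs = 0)}"

definition scale_cochain ::
  "('k \<Rightarrow> 'v \<Rightarrow> 'v) \<Rightarrow> 'k \<Rightarrow> ('g list \<Rightarrow> 'v) \<Rightarrow> 'g list \<Rightarrow> 'v"
  where "scale_cochain scalev c \<eta> = (\<lambda>xs. scalev c (\<eta> xs))"

text \<open>
  List positions are counted from 0.  Shifting both indices by one turns the sign
  \<open>(-1)^(i+1)\<close> of the 1-based formula into \<open>(-1)^i\<close> and leaves \<open>(-1)^(i+j)\<close> unchanged.
  The list \<open>nths ys (- I)\<close> is \<open>ys\<close> with the entries at the positions in \<open>I\<close> omitted.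
\<close>

definition coboundary ::
  "('g \<Rightarrow> 'g \<Rightarrow> 'g) \<Rightarrow> ('g \<Rightarrow> 'g) \<Rightarrow> ('k::field \<Rightarrow> 'v::ab_group_add \<Rightarrow> 'v)
    \<Rightarrow> ('v \<Rightarrow> 'v) \<Rightarrow> ('g \<Rightarrow> 'v \<Rightarrow> 'v) \<Rightarrow> nat \<Rightarrow> nat \<Rightarrow> ('g list \<Rightarrow> 'v) \<Rightarrow> 'g list \<Rightarrow> 'v"
  where "coboundary br \<alpha> scalev \<beta> \<rho> s k \<eta> xs =
    (if length xs = k + 1 then
       (\<Sum>i<k+1. scalev ((-1) ^ i)
          ((\<beta> ^^ (k + 1 + s)) (\<rho> (xs ! i) ((inv \<beta> ^^ (k + 2 + s))
             (\<eta> (nths (map \<alpha> xs) (- {i}))))))) +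
       (\<Sum>j<k+1. \<Sum>i<j. scalev ((-1) ^ (i + j))
          (\<eta> (br (xs ! i) (xs ! j) # nths (map \<alpha> xs) (- {i, j}))))
     else 0)"

definition closed_cochains ::
  "('k::field \<Rightarrow> 'g::ab_group_add \<Rightarrow> 'g) \<Rightarrow> ('g \<Rightarrow> 'g \<Rightarrow> 'g) \<Rightarrow> ('g \<Rightarrow> 'g)
    \<Rightarrow> ('k \<Rightarrow> 'v::ab_group_add \<Rightarrow> 'v) \<Rightarrow> ('v \<Rightarrow> 'v) \<Rightarrow> ('g \<Rightarrow> 'v \<Rightarrow> 'v) \<Rightarrow> nat \<Rightarrow> nat
    \<Rightarrow> ('g list \<Rightarrow> 'v) set"
  where "closed_cochains scaleg br \<alpha> scalev \<beta> \<rho> s k =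
    {\<eta> \<in> cochains scaleg scalev k. coboundary br \<alpha> scalev \<beta> \<rho> s k \<eta> = 0}"

definition exact_cochains ::
  "('k::field \<Rightarrow> 'g::ab_group_add \<Rightarrow> 'g) \<Rightarrow> ('g \<Rightarrow> 'g \<Rightarrow> 'g) \<Rightarrow> ('g \<Rightarrow> 'g)
    \<Rightarrow> ('k \<Rightarrow> 'v::ab_group_add \<Rightarrow> 'v) \<Rightarrow> ('v \<Rightarrow> 'v) \<Rightarrow> ('g \<Rightarrow> 'v \<Rightarrow> 'v) \<Rightarrow> nat \<Rightarrow> nat
    \<Rightarrow> ('g list \<Rightarrow> 'v) set"
  where "exact_cochains scaleg br \<alpha> scalev \<beta> \<rho> s k =
    (case k of 0 \<Rightarrow> {0}
     | Suc m \<Rightarrow> coboundary br \<alpha> scalev \<beta> \<rho> s m ` cochains scaleg scalev m)"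

text \<open>
  The quotient of a subspace \<open>Z\<close> by a subspace \<open>B\<close> of \<open>Z\<close> is the set of cosets.  The sum of two
  cosets is their elementwise sum.  For the scalar multiple one has to add \<open>B\<close> in order to
  get a full coset when the scalar is 0.
\<close>

definition quotient_space :: "'w::ab_group_add set \<Rightarrow> 'w set \<Rightarrow> 'w set set"
  where "quotient_space Z B = (\<lambda>z. z +o B) ` Z"

definition quotient_scale :: "('k \<Rightarrow> 'w::ab_group_add \<Rightarrow> 'w) \<Rightarrow> 'w set \<Rightarrow> 'k \<Rightarrow> 'w set \<Rightarrow> 'w set"
  where "quotient_scale scale B c X = scale c ` X + B"

definition quotients_isomorphic ::
  "('k \<Rightarrow> 'w::ab_group_add \<Rightarrow> 'w) \<Rightarrow> 'w set \<Rightarrow> 'w set \<Rightarrow> 'w set \<Rightarrow> 'w set \<Rightarrow> bool"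
  where "quotients_isomorphic scale Z B Z' B' \<longleftrightarrow>
    (\<exists>\<phi>. bij_betw \<phi> (quotient_space Z B) (quotient_space Z' B') \<and>
         (\<forall>X\<in>quotient_space Z B. \<forall>Y\<in>quotient_space Z B. \<phi> (X + Y) = \<phi> X + \<phi> Y) \<and>
         (\<forall>c. \<forall>X\<in>quotient_space Z B.
            \<phi> (quotient_scale scale B c X) = quotient_scale scale B' c (\<phi> X)))"

lemma self_eq_uminus_imp_zero:
  fixes scale :: "'k::field \<Rightarrow> 'v::ab_group_add \<Rightarrow> 'v" and v :: 'v
  assumes "vector_space scale" and "(2::'k) \<noteq> 0" and "v = - v"
  shows "v = 0"
proof -
  interpret vector_space scale by fact
  have "scale 2 v = scale 1 v + scale 1 v"
    by (metis one_add_one scale_left_distrib)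
  also have "\<dots> = 0" using assms(3) by (metis add.right_inverse scale_one)
  finally show ?thesis using assms(2) by simp
qed

lemma alternating2_iff_skew:
  fixes scaleg :: "'k::field \<Rightarrow> 'g::ab_group_add \<Rightarrow> 'g"
    and scalev :: "'k \<Rightarrow> 'v::ab_group_add \<Rightarrow> 'v"
  assumes two: "(2::'k) \<noteq> 0"
    and left: "\<And>y. Vector_Spaces.linear scaleg scalev (\<lambda>x. f x y)"
    and right: "\<And>x. Vector_Spaces.linear scaleg scalev (f x)"
  shows "(\<forall>x. f x x = 0) \<longleftrightarrow> (\<forall>x y. f y x = - f x y)"
proof
  assume alt: "\<forall>x. f x x = 0"
  show "\<forall>x y. f y x = - f x y"
  proof (intro allI)
    fix x y
    have "f (x + y) (x + y) = f x (x + y) + f y (x + y)"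
      using left[of "x + y"] by (simp add: Vector_Spaces.linear_iff)
    also have "\<dots> = (f x x + f x y) + (f y x + f y y)"
      using right by (simp add: Vector_Spaces.linear_iff)
    finally have "f x y + f y x = 0" using alt by simp
    then show "f y x = - f x y" by (simp add: eq_neg_iff_add_eq_0 add.commute)
  qed
next
  have vs: "vector_space scalev" using left by (simp add: Vector_Spaces.linear_iff)
  assume "\<forall>x y. f y x = - f x y"
  then show "\<forall>x. f x x = 0" using self_eq_uminus_imp_zero[OF vs two] by blast
qed

lemma multilinear_alternating_iff_skew:
  fixes scaleg :: "'k::field \<Rightarrow> 'g::ab_group_add \<Rightarrow> 'g"
    and scalev :: "'k \<Rightarrow> 'v::ab_group_add \<Rightarrow> 'v"
  assumes two: "(2::'k) \<noteq> 0" and ml: "multilinear scaleg scalev k \<eta>"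
  shows "(\<forall>xs. length xs = k \<longrightarrow> \<not> distinct xs \<longrightarrow> \<eta> xs = 0) \<longleftrightarrow>
    (\<forall>xs i j. length xs = k \<longrightarrow> i < k \<longrightarrow> j < k \<longrightarrow> i \<noteq> j \<longrightarrow>
       \<eta> (xs[i := xs ! j, j := xs ! i]) = - \<eta> xs)"
    (is "?alt \<longleftrightarrow> ?skew")
proof -
  have iff: "(\<forall>x. \<eta> (xs[i := x, j := x]) = 0) \<longleftrightarrow>
      (\<forall>x y. \<eta> (xs[i := y, j := x]) = - \<eta> (xs[i := x, j := y]))"
    if "length xs = k" "i < k" "j < k" "i \<noteq> j" for xs i j
  proof (rule alternating2_iff_skew[OF two])
    show "Vector_Spaces.linear scaleg scalev (\<lambda>x. \<eta> (xs[i := x, j := y]))" for y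
    proof -
      have "Vector_Spaces.linear scaleg scalev (\<lambda>x. \<eta> ((xs[j := y])[i := x]))"
        using ml that unfolding multilinear_def by simp
      then show ?thesis by (simp only: list_update_swap[OF that(4)])
    qed
    show "Vector_Spaces.linear scaleg scalev (\<lambda>y. \<eta> (xs[i := x, j := y]))" for x
      using ml that unfolding multilinear_def by simp
  qed
  show ?thesis
  proof
    assume alt: ?alt
    show ?skew
    proof (intro allI impI)
      fix xs :: "'g list" and i j assume *: "length xs = k" "i < k" "j < k" "i \<noteq> j"
      have "\<forall>x. \<eta> (xs[i := x, j := x]) = 0"
      proof
        fix x
        have "\<not> distinct (xs[i := x, j := x])"
          unfolding distinct_conv_nth using *
          by (metis length_list_update nth_list_update_eq nth_list_update_neq)
        then show "\<eta> (xs[i := x, j := x]) = 0" using alt * by simp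
      qed
      then have "\<eta> (xs[i := xs ! j, j := xs ! i]) = - \<eta> (xs[i := xs ! i, j := xs ! j])"
        using iff[OF *] by blast
      then show "\<eta> (xs[i := xs ! j, j := xs ! i]) = - \<eta> xs" by simp
    qed
  next
    assume skew: ?skew
    show ?alt
    proof (intro allI impI)
      fix xs :: "'g list" assume len: "length xs = k" and "\<not> distinct xs"
      then obtain i j where *: "i < k" "j < k" "i \<noteq> j" "xs ! i = xs ! j"
        unfolding distinct_conv_nth by blast
      have "xs[i := xs ! j, j := xs ! i] = xs"
        using *(4) list_update_id[of xs j] list_update_id[of xs i] by simp
      then have "\<eta> xs = - \<eta> xs"
        using skew[rule_format, OF len *(1-3)] by simp
      moreover have "vector_space scalev"
        using ml[unfolded multilinear_def, rule_format, OF len *(1)]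
        by (simp add: Vector_Spaces.linear_iff)
      ultimately show "\<eta> xs = 0" using self_eq_uminus_imp_zero[OF _ two] by blast
    qed
  qed
qed

end

theory Submission
  imports Defs
begin

text \<open>
  Composition with \<open>\<beta>\<close> is a bijection of cochains that carries \<open>d\<^sup>s\<close> to \<open>d\<^sup>s\<^sup>+\<^sup>1\<close>: the additional
  powers \<open>\<beta>\<close> and \<open>\<beta>\<^sup>-\<^sup>1\<close> around \<open>\<rho>(x\<^sub>i)\<close> in \<open>d\<^sup>s\<^sup>+\<^sup>1\<close> cancel against it.
\<close>

lemma quotients_isomorphic_image:
  fixes F :: "'w::ab_group_add \<Rightarrow> 'w"
  assumes inj: "inj F"
    and add: "\<And>x y. F (x + y) = F x + F y"
    and scale: "\<And>c x. F (scale c x) = scale c (F x)"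
  shows "quotients_isomorphic scale Z B (F ` Z) (F ` B)"
proof -
  have plus: "F ` (X + Y) = F ` X + F ` Y" for X Y
    unfolding set_plus_def by (force simp: add)
  have coset: "F ` (z +o B) = F z +o F ` B" for z
    unfolding elt_set_plus_def by (force simp: add)
  have "(`) F ` quotient_space Z B = quotient_space (F ` Z) (F ` B)"
    by (simp add: quotient_space_def image_image coset)
  moreover have "inj_on ((`) F) (quotient_space Z B)"
    using inj by (auto intro: inj_onI simp: inj_image_eq_iff)
  \<comment> \<open>The summand \<open>B\<close> in the scalar multiple is carried along by
    \<open>plus\<close>, so the case of the scalar 0 needs no separate treatment.\<close>
  moreover have "F ` quotient_scale scale B c X = quotient_scale scale (F ` B) c (F ` X)" for c X
    by (simp add: quotient_scale_def plus image_image scale)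
  ultimately show ?thesis
    unfolding quotients_isomorphic_def bij_betw_def
    by (intro exI[of _ "(`) F"]) (simp add: plus)
qed

lemma linear_inv:
  assumes "Vector_Spaces.linear scale scale f" and "bij f"
  shows "Vector_Spaces.linear scale scale (inv f)"
proof -
  from assms(1) interpret Vector_Spaces.linear scale scale f .
  have f_inv: "f (inv f y) = y" and inv_f: "inv f (f x) = x" for x y
    using \<open>bij f\<close> by (simp_all add: bij_is_surj surj_f_inv_f bij_is_inj)
  have "inv f (x + y) = inv f x + inv f y" for x y
    using inv_f[of "inv f x + inv f y"] by (simp add: add f_inv)
  moreover have "inv f (scale c x) = scale c (inv f x)" for c x
    using inv_f[of "scale c (inv f x)"] by (simp add: scale f_inv)
  ultimately show ?thesis
    using vs1.vector_space_axioms by (simp add: Vector_Spaces.linear_iff)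
qed

text \<open>Both vanishing conditions on a cochain, on lists of the wrong length and on repeated
  arguments, survive because \<open>f 0 = 0\<close>.\<close>

lemma cochains_compose:
  assumes f: "Vector_Spaces.linear scalev scalev f" and "\<eta> \<in> cochains scaleg scalev k"
  shows "f \<circ> \<eta> \<in> cochains scaleg scalev k"
proof -
  interpret f: Vector_Spaces.linear scalev scalev f by (rule f)
  have "Vector_Spaces.linear scaleg scalev (\<lambda>x. f (\<eta> (xs[i := x])))"
    if "length xs = k" "i < k" for xs i
    using that assms(2) Vector_Spaces.linear_compose[OF _ f, of scaleg "\<lambda>x. \<eta> (xs[i := x])"]
    by (simp add: cochains_def multilinear_def o_def)
  then show ?thesis
    using assms(2) by (simp add: cochains_def multilinear_def f.zero)
qed

context hom_lie_representation
begin

lemma inv_\<beta>_\<beta>: "inv \<beta> \<circ> \<beta> = id" "\<beta> \<circ> inv \<beta> = id"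
  using bij_\<beta> by (blast dest: bij_is_inj bij_is_surj inv_o_cancel surj_iff[THEN iffD1])+

lemma \<beta>_zero: "\<beta> 0 = 0"
proof -
  interpret \<beta>: Vector_Spaces.linear scalev scalev \<beta> by (rule linear_\<beta>)
  show ?thesis by (rule \<beta>.zero)
qed

lemma inj_compose_\<beta>: "inj (\<lambda>\<eta> :: 'x \<Rightarrow> 'v. \<beta> \<circ> \<eta>)"
  using bij_\<beta> by (intro injI) (simp add: fun_eq_iff bij_is_inj inj_eq)

lemma compose_\<beta>_eq_0_iff: "\<beta> \<circ> \<theta> = 0 \<longleftrightarrow> \<theta> = 0"
  using inj_eq[OF inj_compose_\<beta>, of \<theta> 0] by (simp add: \<beta>_zero zero_fun_def o_def)

text \<open>The converse direction composes once more, with the linear map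
  \<open>inv \<beta>\<close>.\<close>

lemma compose_\<beta>_mem_cochains_iff:
  "\<beta> \<circ> \<eta> \<in> cochains scaleg scalev k \<longleftrightarrow> \<eta> \<in> cochains scaleg scalev k"
  using cochains_compose[OF linear_\<beta>, of \<eta>]
    cochains_compose[OF linear_inv[OF linear_\<beta> bij_\<beta>], of "\<beta> \<circ> \<eta>"]
  by (metis o_assoc inv_\<beta>_\<beta>(1) id_o)

lemma compose_\<beta>_image_cochains:
  "(\<circ>) \<beta> ` cochains scaleg scalev k = cochains scaleg scalev k"
proof -
  have "\<beta> \<circ> (inv \<beta> \<circ> \<eta>) = \<eta>" for \<eta> :: "'g list \<Rightarrow> 'v"
    by (simp add: o_assoc inv_\<beta>_\<beta>)
  then have "\<eta> \<in> (\<circ>) \<beta> ` cochains scaleg scalev k" if "\<eta> \<in> cochains scaleg scalev k" for \<eta>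
    using that compose_\<beta>_mem_cochains_iff[of "inv \<beta> \<circ> \<eta>" k]
    by (intro image_eqI[of _ _ "inv \<beta> \<circ> \<eta>"]) simp_all
  then show ?thesis by (auto simp: compose_\<beta>_mem_cochains_iff)
qed

lemma coboundary_compose_\<beta>:
  "coboundary br \<alpha> scalev \<beta> \<rho> (Suc s) k (\<beta> \<circ> \<eta>) = \<beta> \<circ> coboundary br \<alpha> scalev \<beta> \<rho> s k \<eta>"
proof
  fix xs
  interpret \<beta>: Vector_Spaces.linear scalev scalev \<beta> by (rule linear_\<beta>)
  have "inv \<beta> (\<beta> v) = v" for v using inv_\<beta>_\<beta>(1) by (simp add: fun_eq_iff)
  \<comment> \<open>The extra \<open>inv \<beta>\<close> is split off at the inner end of the power,
    where it meets \<open>\<beta> v\<close>; the extra \<open>\<beta>\<close> of the outer power is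
    split off at its outer end below.\<close>
  then have "(inv \<beta> ^^ Suc n) (\<beta> v) = (inv \<beta> ^^ n) v" for n v
    by (simp only: funpow_Suc_right o_apply)
  then have "(\<beta> ^^ (k + 1 + Suc s)) (\<rho> x ((inv \<beta> ^^ (k + 2 + Suc s)) (\<beta> v))) =
      \<beta> ((\<beta> ^^ (k + 1 + s)) (\<rho> x ((inv \<beta> ^^ (k + 2 + s)) v)))" for x v
    by (simp only: add_Suc_right funpow.simps(2) o_apply)
  then show "coboundary br \<alpha> scalev \<beta> \<rho> (Suc s) k (\<beta> \<circ> \<eta>) xs =
      (\<beta> \<circ> coboundary br \<alpha> scalev \<beta> \<rho> s k \<eta>) xs"
    \<comment> \<open>It remains to pull \<open>\<beta>\<close> out of the sums, signs and case
      distinction by linearity; this alone settles the bracket terms, which contain no power of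
      \<open>\<beta>\<close>.\<close>
    unfolding coboundary_def o_apply
    by (simp only: \<beta>.add \<beta>.sum \<beta>.scale \<beta>.zero if_distrib[of \<beta>])
qed

lemma compose_\<beta>_image_closed_cochains:
  "(\<circ>) \<beta> ` closed_cochains scaleg br \<alpha> scalev \<beta> \<rho> s k =
    closed_cochains scaleg br \<alpha> scalev \<beta> \<rho> (Suc s) k"
proof -
  \<comment> \<open>Closedness for \<open>s\<close> becomes a condition on
    \<open>\<beta> \<circ> \<eta>\<close> alone, and by the previous image lemma
    \<open>\<beta> \<circ> \<eta>\<close> runs through all cochains.\<close>
  have "closed_cochains scaleg br \<alpha> scalev \<beta> \<rho> s k =
      {\<eta> \<in> cochains scaleg scalev k. coboundary br \<alpha> scalev \<beta> \<rho> (Suc s) k (\<beta> \<circ> \<eta>) = 0}"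
    by (simp add: closed_cochains_def coboundary_compose_\<beta> compose_\<beta>_eq_0_iff)
  then show ?thesis
    using compose_\<beta>_image_cochains[of k] by (auto simp: closed_cochains_def)
qed

lemma compose_\<beta>_image_exact_cochains:
  "(\<circ>) \<beta> ` exact_cochains scaleg br \<alpha> scalev \<beta> \<rho> s k =
    exact_cochains scaleg br \<alpha> scalev \<beta> \<rho> (Suc s) k"
proof (cases k)
  case 0
  then show ?thesis
    using \<beta>_zero by (simp add: exact_cochains_def zero_fun_def o_def)
next
  case (Suc m)
  \<comment> \<open>Apply the coboundary for \<open>Suc s\<close> to both sides of
    \<open>\<beta> \<circ> C = C\<close>, where \<open>C\<close> is the space of
    \<open>m\<close>-cochains; on the left, \<open>\<beta>\<close> moves outside and leaves the
    coboundary for \<open>s\<close>.\<close>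
  then show ?thesis
    using arg_cong[OF compose_\<beta>_image_cochains[of m],
        of "(`) (coboundary br \<alpha> scalev \<beta> \<rho> (Suc s) m)"]
    by (simp add: exact_cochains_def image_image coboundary_compose_\<beta>)
qed

end

theorem theorem2p6:
  fixes scaleg :: "'k::field \<Rightarrow> 'g::ab_group_add \<Rightarrow> 'g"
    and br :: "'g \<Rightarrow> 'g \<Rightarrow> 'g" and \<alpha> :: "'g \<Rightarrow> 'g"
    and scalev :: "'k \<Rightarrow> 'v::ab_group_add \<Rightarrow> 'v"
    and \<beta> :: "'v \<Rightarrow> 'v" and \<rho> :: "'g \<Rightarrow> 'v \<Rightarrow> 'v"
    and s k :: nat
  assumes "hom_lie_representation scaleg br \<alpha> scalev \<beta> \<rho>"
  shows "quotients_isomorphic (scale_cochain scalev)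
    (closed_cochains scaleg br \<alpha> scalev \<beta> \<rho> s k)
    (exact_cochains scaleg br \<alpha> scalev \<beta> \<rho> s k)
    (closed_cochains scaleg br \<alpha> scalev \<beta> \<rho> (s + 1) k)
    (exact_cochains scaleg br \<alpha> scalev \<beta> \<rho> (s + 1) k)"
proof -
  interpret hom_lie_representation scaleg br \<alpha> scalev \<beta> \<rho> by fact
  interpret \<beta>: Vector_Spaces.linear scalev scalev \<beta> by (rule linear_\<beta>)
  show ?thesis
    \<comment> \<open>Read from right to left, the image lemmas present the spaces for
      \<open>s + 1\<close> as images of those for \<open>s\<close>, the form that
      \<open>quotients_isomorphic_image\<close> requires.\<close>
    unfolding Suc_eq_plus1[symmetric] compose_\<beta>_image_closed_cochains[symmetric]
      compose_\<beta>_image_exact_cochains[symmetric]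
    by (rule quotients_isomorphic_image)
      (use inj_compose_\<beta> in \<open>simp_all add: fun_eq_iff scale_cochain_def \<beta>.add \<beta>.scale\<close>)
qed

end
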